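(* Let the 3-pan be the graph on vertices $e_1,e_2,e_3,e_4$ with edges $e_1e_2$, $e_2e_3$, $e_2e_4$, $e_3e_4$. Let $H$ be the $(e_1,2)$-ordering of the 3-pan. Then $R_<(H)\le 10$.
   Context: A $k$-ordering of a graph $H$ assigns distinct order-labels from $\{1,\ldots,|H|\}$ to $k$ of the vertices of $H$. For a vertex $v$ of $H$ and $1\le l\le |H|$, the $(v,l)$-ordering of $H$ is the 1-ordering in which $v$ receives order-label $l$ and no other vertex is labeled. An ordered 2-coloring on $n$ vertices is a red/blue coloring of the edges of the complete graph on vertex set $\{1,\ldots,n\}$. It contains a $k$-ordering $H$ (in a given color) if it has a subgraph isomorphic to $H$, all of whose edges have that color, such that for every $i$ the $i$-th smallest vertex of the copy corresponds to a vertex of $H$ that has order-label $i$ or no order-label. $R_<(H)$ is the least $n$ such that every ordered 2-coloring on $n$ vertices contains a monochromatic (red or blue) copy of $H$. *)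

theory Defs
  imports Main
begin

record 'a graph =
  verts :: "'a set"
  edges :: "'a set set"

definition simple_graph :: "'a graph \<Rightarrow> bool" where
  "simple_graph G \<longleftrightarrow> finite (verts G) \<and> (\<forall>e\<in>edges G. e \<subseteq> verts G \<and> card e = 2)"

definition graph_iso :: "('a \<Rightarrow> 'b) \<Rightarrow> 'a graph \<Rightarrow> 'b graph \<Rightarrow> bool" where
  "graph_iso f G G' \<longleftrightarrow> bij_betw f (verts G) (verts G') \<and> edges G' = (\<lambda>e. f ` e) ` edges G"

definition subgraph :: "'a graph \<Rightarrow> 'a graph \<Rightarrow> bool" where
  "subgraph G' G \<longleftrightarrow> simple_graph G' \<and> verts G' \<subseteq> verts G \<and> edges G' \<subseteq> edges G"

definition complete_graph :: "nat \<Rightarrow> nat graph" where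
  "complete_graph n = \<lparr>verts = {1..n}, edges = {e. e \<subseteq> {1..n} \<and> card e = 2}\<rparr>"

text \<open>An ordering is a pair \<open>(G, lab)\<close>; \<open>lab v = None\<close> means that \<open>v\<close> carries no order-label.\<close>

definition k_ordering :: "nat \<Rightarrow> 'a graph \<times> ('a \<rightharpoonup> nat) \<Rightarrow> bool" where
  "k_ordering k H \<longleftrightarrow> (case H of (G, lab) \<Rightarrow>
     simple_graph G \<and> dom lab \<subseteq> verts G \<and> card (dom lab) = k \<and>
     inj_on lab (dom lab) \<and> ran lab \<subseteq> {1..card (verts G)})"

definition vertex_ordering :: "'a graph \<Rightarrow> 'a \<Rightarrow> nat \<Rightarrow> 'a graph \<times> ('a \<rightharpoonup> nat)" where
  "vertex_ordering G v l = (G, [v \<mapsto> l])"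

lemma k_ordering_vertex_ordering:
  assumes "simple_graph G" "v \<in> verts G" "1 \<le> l" "l \<le> card (verts G)"
  shows "k_ordering 1 (vertex_ordering G v l)"
  using assms by (simp add: k_ordering_def vertex_ordering_def)

datatype colour = Red | Blue

text \<open>A colouring of the edges of \<open>complete_graph n\<close> is a function \<open>nat set \<Rightarrow> colour\<close>, of which only
  the values on the edges matter. \<open>sorted_list_of_set (verts S) ! (i - 1)\<close> is the \<open>i\<close>-th smallest
  vertex of the copy \<open>S\<close>.\<close>

definition contains_copy ::
    "nat \<Rightarrow> (nat set \<Rightarrow> colour) \<Rightarrow> colour \<Rightarrow> 'a graph \<times> ('a \<rightharpoonup> nat) \<Rightarrow> bool" where
  "contains_copy n c col H \<longleftrightarrow> (case H of (G, lab) \<Rightarrow>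
     \<exists>S f. subgraph S (complete_graph n) \<and> graph_iso f G S \<and>
       (\<forall>e\<in>edges S. c e = col) \<and>
       (\<forall>i\<in>{1..card (verts G)}. \<forall>v\<in>verts G.
          f v = sorted_list_of_set (verts S) ! (i - 1) \<longrightarrow> lab v = Some i \<or> lab v = None))"

definition ordered_ramsey :: "'a graph \<times> ('a \<rightharpoonup> nat) \<Rightarrow> nat" where
  "ordered_ramsey H =
     (LEAST n. \<forall>c. contains_copy n c Red H \<or> contains_copy n c Blue H)"

datatype pan_vertex = e1 | e2 | e3 | e4

definition three_pan :: "pan_vertex graph" where
  "three_pan = \<lparr>verts = {e1, e2, e3, e4}, edges = {{e1, e2}, {e2, e3}, {e2, e4}, {e3, e4}}\<rparr>"

lemma simple_graph_three_pan: "simple_graph three_pan"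
  by (simp add: simple_graph_def three_pan_def)

lemma k_ordering_three_pan: "k_ordering 1 (vertex_ordering three_pan e1 2)"
  by (rule k_ordering_vertex_ordering[OF simple_graph_three_pan]) (simp_all add: three_pan_def)

end

theory Submission
  imports Defs
begin

text \<open>Vertex 1 has nine neighbours, so five of them, \<open>r0 < r1 < r2 < r3 < r4\<close>, are joined to it in the
  same colour. An edge of that colour among \<open>r1, ..., r4\<close> closes a triangle at 1 whose pendant vertex
  is \<open>r0\<close>. Otherwise \<open>r1, ..., r4\<close> form a clique of the other colour, and such a clique contains the
  pan with triangle \<open>r1, r3, r4\<close> and pendant vertex \<open>r2\<close>.\<close>

text \<open>The triangle is \<open>x, y, z\<close>, and the pendant edge hangs at its smallest
  vertex \<open>x\<close>. As \<open>a\<close> lies between \<open>x\<close> and \<open>y\<close>,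
  it is the second smallest vertex, the place that the label of \<open>e1\<close> demands. The
  colours of \<open>{a, y}\<close> and \<open>{a, z}\<close> are free.\<close>

lemma contains_copy_three_panI:
  assumes less: "x < a" "a < y" "y < z" and bounds: "1 \<le> x" "z \<le> n"
    and colours: "c {x, a} = col" "c {x, y} = col" "c {x, z} = col" "c {y, z} = col"
  shows "contains_copy n c col (vertex_ordering three_pan e1 2)"
proof -
  define f where "f v = (case v of e1 \<Rightarrow> a | e2 \<Rightarrow> x | e3 \<Rightarrow> y | e4 \<Rightarrow> z)" for v
  define S where "S = \<lparr>verts = {x, a, y, z}, edges = {{x, a}, {x, y}, {x, z}, {y, z}}\<rparr>"
  have "subgraph S (complete_graph n)"
    using less bounds by (auto simp: subgraph_def simple_graph_def complete_graph_def S_def)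
  moreover have "graph_iso f three_pan S"
    using less by (auto simp: graph_iso_def three_pan_def S_def f_def bij_betw_def inj_on_def)
  moreover have "\<forall>e\<in>edges S. c e = col"
    using colours by (simp add: S_def)
  \<comment> \<open>Only \<open>e1\<close> carries a label, so the order condition reduces to the
    position of its image \<open>a\<close>.\<close>
  moreover have "i = 2"
    if "i \<in> {1..card (verts three_pan)}" "f e1 = sorted_list_of_set (verts S) ! (i - 1)" for i
  proof -
    have sorted: "sorted_list_of_set (verts S) = [x, a, y, z]"
      using less by (simp add: S_def)
    have "i \<in> {1, 2, 3, 4}"
      using that(1) by (auto simp: three_pan_def)
    then show ?thesis
      using that(2) less unfolding sorted by (auto simp: f_def)
  qed
  ultimately show ?thesis
    unfolding contains_copy_def vertex_ordering_def prod.case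
    by (intro exI[of _ S] exI[of _ f] conjI) auto
qed

text \<open>Keeping \<open>col\<close> and \<open>col'\<close> arbitrary lets one argument serve
  both possible majority colours at vertex 1.\<close>

lemma contains_copy_of_five_neighbours:
  assumes N: "N \<subseteq> {2..n}" "5 \<le> card N" and col: "\<And>v. v \<in> N \<Longrightarrow> c {1, v} = col" and "col \<noteq> col'"
  shows "contains_copy n c col (vertex_ordering three_pan e1 2) \<or>
    contains_copy n c col' (vertex_ordering three_pan e1 2)"
proof (cases "\<exists>a\<in>N. \<exists>y\<in>N. \<exists>z\<in>N. a < y \<and> y < z \<and> c {y, z} = col")
  case True
  then obtain a y z where ayz: "a \<in> N" "y \<in> N" "z \<in> N" "a < y" "y < z" "c {y, z} = col"
    by blast
  have "contains_copy n c col (vertex_ordering three_pan e1 2)"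
    using ayz col N(1) by (intro contains_copy_three_panI[of 1 a y z]) auto
  then show ?thesis ..
next
  case False
  have fin: "finite N"
    using N(1) finite_subset by blast
  define r where "r i = sorted_list_of_set N ! i" for i
  have r_mem: "r i \<in> N" if "i < 5" for i
    using that N(2) fin nth_mem[of i "sorted_list_of_set N"] by (simp add: r_def)
  have r_less: "r i < r j" if "i < j" "j < 5" for i j
    using that N(2) strict_sorted_list_of_set[of N]
    by (simp add: r_def sorted_wrt_nth_less)
  have other: "c {r i, r j} = col'" if "0 < i" "i < j" "j < 5" for i j
  proof -
    \<comment> \<open>Here \<open>r 0\<close> plays the part of \<open>a\<close> in the failed case
      condition, which is why \<open>0 < i\<close> is required.\<close>
    have "c {r i, r j} \<noteq> col"
      using False r_mem[of 0] r_mem[of i] r_mem[of j] r_less[of 0 i] r_less[of i j] that by auto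
    then show ?thesis
      using \<open>col \<noteq> col'\<close> by (metis colour.exhaust)
  qed
  have "contains_copy n c col' (vertex_ordering three_pan e1 2)"
    using r_less r_mem[of 1] r_mem[of 4] N(1) other
    by (intro contains_copy_three_panI[of "r 1" "r 2" "r 3" "r 4"]) auto
  then show ?thesis ..
qed

theorem theorem3p11:
  shows "ordered_ramsey (vertex_ordering three_pan e1 2) \<le> 10"
  unfolding ordered_ramsey_def
proof (intro Least_le allI)
  fix c :: "nat set \<Rightarrow> colour"
  define N where "N col = {v \<in> {2..10}. c {1, v} = col}" for col
  have "N Red \<union> N Blue = {2..10}"
    unfolding N_def using colour.exhaust by blast
  \<comment> \<open>Pigeonhole: two classes of size at most 4 cannot cover the nine vertices of
    \<open>{2..10}\<close>.\<close>
  then have "9 \<le> card (N Red) + card (N Blue)"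
    using card_Un_le[of "N Red" "N Blue"] by simp
  then consider "5 \<le> card (N Red)" | "5 \<le> card (N Blue)"
    by linarith
  then show "contains_copy 10 c Red (vertex_ordering three_pan e1 2) \<or>
    contains_copy 10 c Blue (vertex_ordering three_pan e1 2)"
  proof cases
    case 1
    then show ?thesis
      by (intro contains_copy_of_five_neighbours[of "N Red"]) (auto simp: N_def)
  next
    case 2
    then have "contains_copy 10 c Blue (vertex_ordering three_pan e1 2) \<or>
      contains_copy 10 c Red (vertex_ordering three_pan e1 2)"
      by (intro contains_copy_of_five_neighbours[of "N Blue"]) (auto simp: N_def)
    then show ?thesis
      by blast
  qed
qed

end
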